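(* Let $\mathcal{S}$ be a commutative ring (not necessarily containing $\mathbf{Q}$), let $F\in\mathcal{S}$, let $D:\mathcal{S}\to\mathcal{S}$ be a derivation, and let $\{A_{s,l}\}$ be the associated double sequence of elements of $\mathcal{S}$ (defined recursively in the context). Then for all integers $s\geq 2$ and $l\geq 0$, $$ s\,A_{s,l} = \sum_{r=1}^{l+1-s}\binom{l}{r} A_{1,r}\,A_{s-1,l-r}, $$ where a sum whose upper limit is less than $1$ is empty (equal to $0$).
   Context: Given a commutative ring $\mathcal{S}$, an element $F\in\mathcal{S}$ and a derivation $D:\mathcal{S}\to\mathcal{S}$ (an additive map with $D(ab)=D(a)b+aD(b)$), the double sequence $\{A_{s,l}\}$ in $\mathcal{S}$ is defined as follows: $A_{s,l}=0$ unless $0\leq s\leq l$; $A_{0,0}=1$; and, for all $l\geq 0$ and $0\le s\le l+1$, $A_{s,l+1}=F\cdot\bigl(D(A_{s,l})+A_{s-1,l}\bigr)$. In particular $A_{0,l}=0$ for $l>0$, $A_{1,l+1}=(FD)^l(F)$ for $l\geq 0$ (where $FD$ denotes the map $a\mapsto F\cdot D(a)$), and $A_{s,s}=F^s$. *)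

theory Defs
  imports "HOL-Algebra.Ring"
begin

definition ring_derivation :: "('a, 'm) ring_scheme \<Rightarrow> ('a \<Rightarrow> 'a) \<Rightarrow> bool" where
  "ring_derivation S D \<longleftrightarrow>
     D \<in> carrier S \<rightarrow> carrier S \<and>
     (\<forall>a\<in>carrier S. \<forall>b\<in>carrier S. D (a \<oplus>\<^bsub>S\<^esub> b) = D a \<oplus>\<^bsub>S\<^esub> D b) \<and>
     (\<forall>a\<in>carrier S. \<forall>b\<in>carrier S.
        D (a \<otimes>\<^bsub>S\<^esub> b) = D a \<otimes>\<^bsub>S\<^esub> b \<oplus>\<^bsub>S\<^esub> a \<otimes>\<^bsub>S\<^esub> D b)"

text \<open>
  The arguments after \<open>S F D\<close> are the indices \<open>s\<close> and \<open>l\<close>, in this order. As \<open>s\<close> is a natural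
  number, the term with index \<open>s - 1\<close> is replaced by zero explicitly when \<open>s = 0\<close>.
\<close>

fun coeffA :: "('a, 'm) ring_scheme \<Rightarrow> 'a \<Rightarrow> ('a \<Rightarrow> 'a) \<Rightarrow> nat \<Rightarrow> nat \<Rightarrow> 'a" where
  "coeffA S F D s 0 = (if s = 0 then \<one>\<^bsub>S\<^esub> else \<zero>\<^bsub>S\<^esub>)"
| "coeffA S F D s (Suc l) =
     (if s \<le> Suc l
      then F \<otimes>\<^bsub>S\<^esub> (D (coeffA S F D s l) \<oplus>\<^bsub>S\<^esub>
                     (if s = 0 then \<zero>\<^bsub>S\<^esub> else coeffA S F D (s - 1) l))
      else \<zero>\<^bsub>S\<^esub>)"

end

theory Submission imports Defs
begin

text \<open>
  The sequences \<open>A\<^sub>s\<close> are of binomial type: for all \<open>m\<close>, \<open>k\<close> and \<open>l\<close>,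
  \<open>(\<Sum>r\<le>l. (l choose r) A\<^sub>m\<^sub>,\<^sub>r A\<^sub>k\<^sub>,\<^sub>l\<^sub>-\<^sub>r) = (m + k choose m) A\<^sub>m\<^sub>+\<^sub>k\<^sub>,\<^sub>l\<close>.
  Indeed, by Pascal's rule and the Leibniz rule the convolution \<open>P\<^sub>m\<^sub>,\<^sub>k\<^sub>,\<^sub>l\<close> on the left satisfies
  \<open>P\<^sub>m\<^sub>,\<^sub>k\<^sub>,\<^sub>l\<^sub>+\<^sub>1 = F (D P\<^sub>m\<^sub>,\<^sub>k\<^sub>,\<^sub>l + P\<^sub>m\<^sub>-\<^sub>1\<^sub>,\<^sub>k\<^sub>,\<^sub>l + P\<^sub>m\<^sub>,\<^sub>k\<^sub>-\<^sub>1\<^sub>,\<^sub>l)\<close>, which is also the recursion of the right-hand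
  side. The theorem is the case \<open>m = 1\<close>, \<open>k = s - 1\<close>, after dropping the terms that vanish.
\<close>

text \<open>Pascal's rule splits the coefficient at \<open>Suc r\<close>. One half is the shifted
  sum; the other, with the separate term at 0, is the unshifted sum because
  \<open>n choose Suc n\<close> is 0.\<close>

lemma (in abelian_monoid) finsum_binomial_Suc:
  assumes f: "\<And>i. f i \<in> carrier G"
  shows "(\<Oplus>r\<in>{..Suc n}. [(Suc n choose r)] \<cdot> f r) =
    (\<Oplus>r\<in>{..n}. [(n choose r)] \<cdot> f (Suc r)) \<oplus> (\<Oplus>r\<in>{..n}. [(n choose r)] \<cdot> f r)"
proof -
  have shift: "(\<Oplus>r\<in>{..n}. [(n choose Suc r)] \<cdot> f (Suc r)) \<oplus> [(n choose 0)] \<cdot> f 0 =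
      (\<Oplus>r\<in>{..n}. [(n choose r)] \<cdot> f r)"
  proof -
    have "(\<Oplus>r\<in>{..n}. [(n choose Suc r)] \<cdot> f (Suc r)) \<oplus> [(n choose 0)] \<cdot> f 0 =
        (\<Oplus>r\<in>{..Suc n}. [(n choose r)] \<cdot> f r)"
      by (subst finsum_Suc2) (use f in auto)
    also have "\<dots> = (\<Oplus>r\<in>{..n}. [(n choose r)] \<cdot> f r)"
      by (subst finsum_Suc) (use f in \<open>auto simp: binomial_eq_0\<close>)
    finally show ?thesis .
  qed
  have "(\<Oplus>r\<in>{..Suc n}. [(Suc n choose r)] \<cdot> f r) =
      (\<Oplus>r\<in>{..n}. [(Suc n choose Suc r)] \<cdot> f (Suc r)) \<oplus> [(Suc n choose 0)] \<cdot> f 0"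
    by (subst finsum_Suc2) (use f in auto)
  also have "(\<Oplus>r\<in>{..n}. [(Suc n choose Suc r)] \<cdot> f (Suc r)) =
      (\<Oplus>r\<in>{..n}. [(n choose r)] \<cdot> f (Suc r) \<oplus> [(n choose Suc r)] \<cdot> f (Suc r))"
    by (rule finsum_cong') (use f in \<open>auto simp: add.nat_pow_mult\<close>)
  also have "\<dots> = (\<Oplus>r\<in>{..n}. [(n choose r)] \<cdot> f (Suc r)) \<oplus>
      (\<Oplus>r\<in>{..n}. [(n choose Suc r)] \<cdot> f (Suc r))"
    by (rule finsum_addf) (use f in auto)
  finally show ?thesis
    using f by (simp add: add.m_assoc flip: shift)
qed

locale cring_derivation = cring +
  fixes F :: 'a and D :: "'a \<Rightarrow> 'a"
  assumes F_closed [simp]: "F \<in> carrier R"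
    and derivation: "ring_derivation R D"
begin

lemma D_closed [simp]: "a \<in> carrier R \<Longrightarrow> D a \<in> carrier R"
  using derivation by (auto simp: ring_derivation_def)

lemma D_add [simp]: "\<lbrakk>a \<in> carrier R; b \<in> carrier R\<rbrakk> \<Longrightarrow> D (a \<oplus> b) = D a \<oplus> D b"
  using derivation by (auto simp: ring_derivation_def)

lemma D_mult [simp]:
  "\<lbrakk>a \<in> carrier R; b \<in> carrier R\<rbrakk> \<Longrightarrow> D (a \<otimes> b) = D a \<otimes> b \<oplus> a \<otimes> D b"
  using derivation by (auto simp: ring_derivation_def)

lemma D_zero [simp]: "D \<zero> = \<zero>"
  using D_add[of \<zero> \<zero>] add.r_cancel_one[of "D \<zero>" "D \<zero>"] by simp

lemma D_add_pow [simp]: "a \<in> carrier R \<Longrightarrow> D ([(n::nat)] \<cdot> a) = [n] \<cdot> D a"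
  by (induction n) auto

lemma D_finsum:
  assumes "\<And>i. i \<in> A \<Longrightarrow> f i \<in> carrier R"
  shows "D (\<Oplus>i\<in>A. f i) = (\<Oplus>i\<in>A. D (f i))"
  using assms by (induction A rule: infinite_finite_induct) (auto simp: Pi_def)

lemma coeffA_closed [simp]: "coeffA R F D s l \<in> carrier R"
  by (induction l arbitrary: s) auto

lemma coeffA_eq_zero: "l < s \<Longrightarrow> coeffA R F D s l = \<zero>"
  by (cases l) auto

text \<open>The value at \<open>s = 0\<close> replaces the case distinction in the recursion, and
  for fixed \<open>s\<close> this is a sequence that can enter a convolution.\<close>

definition coeffA_pred :: "nat \<Rightarrow> nat \<Rightarrow> 'a" where
  "coeffA_pred s l = (case s of 0 \<Rightarrow> \<zero> | Suc k \<Rightarrow> coeffA R F D k l)"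

lemma coeffA_pred_simps [simp]:
  "coeffA_pred 0 = (\<lambda>l. \<zero>)" "coeffA_pred (Suc k) = coeffA R F D k"
  by (auto simp: coeffA_pred_def)

lemma coeffA_pred_closed [simp]: "coeffA_pred s l \<in> carrier R"
  by (cases s) auto

text \<open>The guard \<open>s \<le> Suc l\<close> is redundant: if it fails, then
  \<open>l < s - 1\<close>, so both summands on the right vanish.\<close>

lemma coeffA_Suc: "coeffA R F D s (Suc l) = F \<otimes> (D (coeffA R F D s l) \<oplus> coeffA_pred s l)"
  by (cases s) (auto simp: coeffA_eq_zero)

definition binomial_conv :: "(nat \<Rightarrow> 'a) \<Rightarrow> (nat \<Rightarrow> 'a) \<Rightarrow> nat \<Rightarrow> 'a" where
  "binomial_conv u v l = (\<Oplus>r\<in>{..l}. [(l choose r)] \<cdot> (u r \<otimes> v (l - r)))"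

lemma binomial_conv_closed [simp]:
  "\<lbrakk>\<And>i. u i \<in> carrier R; \<And>i. v i \<in> carrier R\<rbrakk> \<Longrightarrow> binomial_conv u v l \<in> carrier R"
  unfolding binomial_conv_def by (rule finsum_closed) auto

lemma binomial_conv_zero_left [simp]:
  "(\<And>i. v i \<in> carrier R) \<Longrightarrow> binomial_conv (\<lambda>r. \<zero>) v l = \<zero>"
  unfolding binomial_conv_def by (rule add.finprod_one_eqI) auto

lemma binomial_conv_zero_right [simp]:
  "(\<And>i. u i \<in> carrier R) \<Longrightarrow> binomial_conv u (\<lambda>r. \<zero>) l = \<zero>"
  unfolding binomial_conv_def by (rule add.finprod_one_eqI) auto

text \<open>Pascal's rule advances one factor at a time. By the recursions for \<open>u\<close> and
  \<open>v\<close>, the two derivative terms combine into \<open>D\<close> of the product, and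
  \<open>u'\<close> and \<open>v'\<close> give the two remaining convolutions.\<close>

lemma binomial_conv_Suc:
  assumes closed [simp]: "\<And>i. u i \<in> carrier R" "\<And>i. v i \<in> carrier R"
      "\<And>i. u' i \<in> carrier R" "\<And>i. v' i \<in> carrier R"
    and u: "\<And>i. u (Suc i) = F \<otimes> (D (u i) \<oplus> u' i)"
    and v: "\<And>i. v (Suc i) = F \<otimes> (D (v i) \<oplus> v' i)"
  shows "binomial_conv u v (Suc l) =
    F \<otimes> (D (binomial_conv u v l) \<oplus> (binomial_conv u' v l \<oplus> binomial_conv u v' l))"
proof -
  let ?c = "\<lambda>r. l choose r"
  have "binomial_conv u v (Suc l) =
      (\<Oplus>r\<in>{..l}. [?c r] \<cdot> (u (Suc r) \<otimes> v (l - r))) \<oplus>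
      (\<Oplus>r\<in>{..l}. [?c r] \<cdot> (u r \<otimes> v (Suc l - r)))"
    unfolding binomial_conv_def
    using finsum_binomial_Suc[of "\<lambda>r. u r \<otimes> v (Suc l - r)" l] by simp
  also have "\<dots> = (\<Oplus>r\<in>{..l}. [?c r] \<cdot> (u (Suc r) \<otimes> v (l - r)) \<oplus>
      [?c r] \<cdot> (u r \<otimes> v (Suc l - r)))"
    by (rule finsum_addf[symmetric]) auto
  also have "\<dots> = (\<Oplus>r\<in>{..l}. F \<otimes> (D ([?c r] \<cdot> (u r \<otimes> v (l - r))) \<oplus>
      ([?c r] \<cdot> (u' r \<otimes> v (l - r)) \<oplus> [?c r] \<cdot> (u r \<otimes> v' (l - r)))))"
  proof (rule finsum_cong')
    fix r assume "r \<in> {..l}"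
    then have diff: "Suc l - r = Suc (l - r)"
      by auto
    \<comment> \<open>Used with \<open>a = D d\<close> and \<open>e = D c\<close>, where
      \<open>d = u r\<close> and \<open>c = v (l - r)\<close>, so that
      \<open>a \<otimes> c \<oplus> d \<otimes> e\<close> is the Leibniz expansion of
      \<open>D (d \<otimes> c)\<close>.\<close>
    have ring_id: "F \<otimes> (a \<oplus> b) \<otimes> c \<oplus> d \<otimes> (F \<otimes> (e \<oplus> f)) =
        F \<otimes> (a \<otimes> c \<oplus> d \<otimes> e \<oplus> (b \<otimes> c \<oplus> d \<otimes> f))"
      if "a \<in> carrier R" "b \<in> carrier R" "c \<in> carrier R"
         "d \<in> carrier R" "e \<in> carrier R" "f \<in> carrier R" for a b c d e f
      using that F_closed by algebra
    show "[?c r] \<cdot> (u (Suc r) \<otimes> v (l - r)) \<oplus> [?c r] \<cdot> (u r \<otimes> v (Suc l - r)) =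
        F \<otimes> (D ([?c r] \<cdot> (u r \<otimes> v (l - r))) \<oplus>
        ([?c r] \<cdot> (u' r \<otimes> v (l - r)) \<oplus> [?c r] \<cdot> (u r \<otimes> v' (l - r))))"
      unfolding diff u v
      by (simp add: ring_id add_pow_rdistr flip: add.nat_pow_distrib del: r_distr l_distr)
  qed auto
  also have "\<dots> = F \<otimes> (\<Oplus>r\<in>{..l}. D ([?c r] \<cdot> (u r \<otimes> v (l - r))) \<oplus>
      ([?c r] \<cdot> (u' r \<otimes> v (l - r)) \<oplus> [?c r] \<cdot> (u r \<otimes> v' (l - r))))"
    by (rule finsum_rdistr[symmetric]) auto
  also have "\<dots> = F \<otimes> (D (binomial_conv u v l) \<oplus>
      (binomial_conv u' v l \<oplus> binomial_conv u v' l))"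
    unfolding binomial_conv_def by (subst D_finsum) (auto simp: Pi_def)
  finally show ?thesis .
qed

lemma binomial_conv_coeffA:
  "binomial_conv (coeffA R F D m) (coeffA R F D k) l =
    [(m + k choose m)] \<cdot> coeffA R F D (m + k) l"
proof (induction l arbitrary: m k)
  case 0
  show ?case
    by (simp add: binomial_conv_def)
next
  case (Suc l)
  let ?A = "coeffA R F D"
  let ?P = "\<lambda>m k. binomial_conv (?A m) (?A k) l"
  \<comment> \<open>For positive \<open>m\<close> and \<open>k\<close> this is Pascal's rule applied
    to the induction hypotheses. If exactly one index is 0, one convolution vanishes and the other
    has coefficient 1.\<close>
  have pred: "binomial_conv (coeffA_pred m) (?A k) l \<oplus> binomial_conv (?A m) (coeffA_pred k) l =
      [(m + k choose m)] \<cdot> coeffA_pred (m + k) l"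
  proof (cases m; cases k)
    fix m' k' assume "m = Suc m'" "k = Suc k'"
    then show ?thesis
      using Suc.IH[of m' k] Suc.IH[of m k']
      by (simp add: add.nat_pow_mult)
  qed (use Suc.IH in simp_all)
  have "binomial_conv (?A m) (?A k) (Suc l) =
      F \<otimes> (D (?P m k) \<oplus> (binomial_conv (coeffA_pred m) (?A k) l \<oplus>
        binomial_conv (?A m) (coeffA_pred k) l))"
    by (rule binomial_conv_Suc) (simp_all add: coeffA_Suc del: coeffA.simps)
  also have "\<dots> = F \<otimes> ([(m + k choose m)] \<cdot> (D (?A (m + k) l) \<oplus> coeffA_pred (m + k) l))"
    by (simp add: pred Suc.IH add.nat_pow_distrib)
  also have "\<dots> = [(m + k choose m)] \<cdot> ?A (m + k) (Suc l)"
    by (simp add: coeffA_Suc add_pow_rdistr del: coeffA.simps)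
  finally show ?case .
qed

end

theorem theorem1:
  fixes S :: "('a, 'm) ring_scheme" and F :: 'a and D :: "'a \<Rightarrow> 'a" and s l :: nat
  assumes "cring S"
    and "F \<in> carrier S"
    and "ring_derivation S D"
    and "s \<ge> 2"
  shows "[s] \<cdot>\<^bsub>S\<^esub> coeffA S F D s l =
    (\<Oplus>\<^bsub>S\<^esub>r\<in>{1..l + 1 - s}.
       [(l choose r)] \<cdot>\<^bsub>S\<^esub> (coeffA S F D 1 r \<otimes>\<^bsub>S\<^esub> coeffA S F D (s - 1) (l - r)))"
proof -
  interpret cring S by fact
  interpret cring_derivation S F D
    by unfold_locales fact+
  have "[s] \<cdot>\<^bsub>S\<^esub> coeffA S F D s l =
      binomial_conv (coeffA S F D 1) (coeffA S F D (s - 1)) l"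
    using binomial_conv_coeffA[of 1 "s - 1" l] \<open>s \<ge> 2\<close> by simp
  also have "\<dots> = (\<Oplus>\<^bsub>S\<^esub>r\<in>{1..l + 1 - s}.
       [(l choose r)] \<cdot>\<^bsub>S\<^esub> (coeffA S F D 1 r \<otimes>\<^bsub>S\<^esub> coeffA S F D (s - 1) (l - r)))"
    unfolding binomial_conv_def
  proof (rule add.finprod_mono_neutral_cong_right)
    \<comment> \<open>At \<open>r = 0\<close> the factor \<open>A_{1,0}\<close> is zero; beyond the
      upper limit the second factor has \<open>l - r < s - 1\<close>. This also covers
      \<open>l + 1 < s\<close>, where the truncated limit is 0 and the range empty.\<close>
    fix r assume r: "r \<in> {..l} - {1..l + 1 - s}"
    show "[(l choose r)] \<cdot>\<^bsub>S\<^esub> (coeffA S F D 1 r \<otimes>\<^bsub>S\<^esub> coeffA S F D (s - 1) (l - r)) = \<zero>\<^bsub>S\<^esub>"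
    proof (cases "r = 0")
      case False
      then have "l - r < s - 1"
        using r \<open>s \<ge> 2\<close> by auto
      then show ?thesis
        by (simp add: coeffA_eq_zero)
    qed simp
  qed (use \<open>s \<ge> 2\<close> in auto)
  finally show ?thesis .
qed

end
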